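(* Let $f,c,\mathcal{A}$ satisfy the standing assumptions stated in the context, let $\beta\in\mathbb{R}$ be a penalty parameter and $h(x)=f(\mathcal{A}(x))+\frac{\beta}{2}\|c(x)\|^2$. For any $x\in\mathcal{M}=\{x\in\mathbb{R}^n:c(x)=0\}$, $x$ is a first-order stationary point of the constrained problem $\min\{f(x):x\in\mathbb{R}^n,\ c(x)=0\}$ if and only if $x$ is a first-order stationary point of $h$.
   Context: **Setting and standing assumptions.** $\|\cdot\|$ is the Euclidean norm. $f:\mathbb{R}^n\to\mathbb{R}$ is locally Lipschitz continuous and differentiable. $c:\mathbb{R}^n\to\mathbb{R}^p$ is differentiable and its transposed Jacobian $J_c(x)\in\mathbb{R}^{n\times p}$ (entries $(J_c(x))_{ij}=\partial c_j/\partial x_i$) is locally Lipschitz continuous. There are an integer $1\le p'\le p$ and a neighborhood $\mathcal{X}$ of $\mathcal{M}$ such that $\operatorname{rank}J_c(x)=p'$ for all $x\in\mathcal{X}$ (relaxed constant rank constraint qualification). $\mathcal{A}:\mathbb{R}^n\to\mathbb{R}^n$ is differentiable with locally Lipschitz transposed Jacobian $J_{\mathcal{A}}(x)\in\mathbb{R}^{n\times n}$ (entries $\partial\mathcal{A}_j/\partial x_i$), $\mathcal{A}(x)=x$ for all $x\in\mathcal{M}$, and $J_{\mathcal{A}}(x)J_c(x)=0$ for all $x\in\mathcal{M}$. **Stationarity.** $x$ is a first-order stationary point of the constrained problem if $c(x)=0$ and there is $\tilde\lambda\in\mathbb{R}^p$ with $\nabla f(x)-\sum_{i=1}^p\tilde\lambda_i\nabla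 c_i(x)=0$. $x$ is a first-order stationary point of $h$ if $\nabla h(x)=0$. *)

theory Defs
  imports "HOL-Analysis.Analysis"
begin

definition locally_lipschitz :: "('a::metric_space \<Rightarrow> 'b::metric_space) \<Rightarrow> bool"
  where "locally_lipschitz F \<longleftrightarrow> (\<forall>x. \<exists>r>0. \<exists>L. L-lipschitz_on (ball x r) F)"

(* The notion of HOL-Analysis.Lipschitz carries an extra time parameter; the two agree
   when that parameter is a dummy. *)
lemma locally_lipschitz_iff_local_lipschitz:
  "locally_lipschitz F \<longleftrightarrow> local_lipschitz {0::real} UNIV (\<lambda>_. F)"
proof
  assume F: "locally_lipschitz F"
  show "local_lipschitz {0::real} UNIV (\<lambda>_. F)"
  proof (rule local_lipschitzI)
    fix t :: real and x
    obtain r L where "r > 0" "L-lipschitz_on (ball x r) F"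
      using F unfolding locally_lipschitz_def by blast
    moreover have "cball x (r / 2) \<subseteq> ball x r"
      using \<open>r > 0\<close> by auto
    ultimately have "r / 2 > 0" "L-lipschitz_on (cball x (r / 2)) F"
      using lipschitz_on_subset by auto
    then show "\<exists>u>0. \<exists>L. \<forall>t\<in>cball t u \<inter> {0}. L-lipschitz_on (cball x u \<inter> UNIV) F"
      by (intro exI[of _ "r / 2"] conjI exI[of _ L] ballI) auto
  qed
next
  assume F: "local_lipschitz {0::real} UNIV (\<lambda>_. F)"
  show "locally_lipschitz F"
    unfolding locally_lipschitz_def
  proof
    fix x
    obtain u L where "u > 0" and L: "\<And>s. s \<in> cball 0 u \<inter> {0::real} \<Longrightarrow> L-lipschitz_on (cball x u \<inter> UNIV) F"
      by (rule local_lipschitzE[OF F, of 0 x]) auto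
    then have "L-lipschitz_on (ball x u) F"
      using lipschitz_on_subset[OF L[of 0], of "ball x u"] by auto
    with \<open>u > 0\<close> show "\<exists>r>0. \<exists>L. L-lipschitz_on (ball x r) F" by blast
  qed
qed

(* Meaningful only where g is differentiable. *)
definition gradient :: "('a::real_inner \<Rightarrow> real) \<Rightarrow> 'a \<Rightarrow> 'a"
  where "gradient g x = (THE D. GDERIV g x :> D)"

lemma gradient_eq:
  assumes "GDERIV g x :> D"
  shows "gradient g x = D"
  unfolding gradient_def
proof (rule the_equality[where P = "\<lambda>E. GDERIV g x :> E", OF assms])
  fix E assume "GDERIV g x :> E"
  then have "(\<lambda>h. h \<bullet> E) = (\<lambda>h. h \<bullet> D)"
    using assms unfolding gderiv_def by (rule has_derivative_unique)
  from fun_cong[OF this, of "E - D"] have "(E - D) \<bullet> (E - D) = 0"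
    by (simp add: inner_diff_right[of _ E D])
  then show "E = D" by simp
qed

(* (tjacobian F x) $ i $ j is the partial derivative of the j-th component of F
   with respect to the i-th coordinate. *)
definition tjacobian :: "(real ^ 'n \<Rightarrow> real ^ 'm) \<Rightarrow> real ^ 'n \<Rightarrow> real ^ 'm ^ 'n"
  where "tjacobian F x = transpose (jacobian F (at x))"

lemma tjacobian_entry:
  "tjacobian F x $ i $ j = frechet_derivative F (at x) (axis i 1) $ j"
  by (simp add: tjacobian_def transpose_def jacobian_def matrix_def)

definition feasible_set :: "(real ^ 'n \<Rightarrow> real ^ 'p) \<Rightarrow> (real ^ 'n) set"
  where "feasible_set c = {x. c x = 0}"

definition penalty :: "(real ^ 'n \<Rightarrow> real) \<Rightarrow> (real ^ 'n \<Rightarrow> real ^ 'p) \<Rightarrow>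
    (real ^ 'n \<Rightarrow> real ^ 'n) \<Rightarrow> real \<Rightarrow> real ^ 'n \<Rightarrow> real"
  where "penalty f c A \<beta> x = f (A x) + \<beta> / 2 * (norm (c x))\<^sup>2"

definition constrained_stationary :: "(real ^ 'n \<Rightarrow> real) \<Rightarrow> (real ^ 'n \<Rightarrow> real ^ 'p) \<Rightarrow>
    real ^ 'n \<Rightarrow> bool"
  where "constrained_stationary f c x \<longleftrightarrow>
    c x = 0 \<and>
    (\<exists>l :: real ^ 'p. gradient f x - (\<Sum>i\<in>UNIV. (l $ i) *\<^sub>R gradient (\<lambda>y. c y $ i) x) = 0)"

definition stationary :: "('a::real_inner \<Rightarrow> real) \<Rightarrow> 'a \<Rightarrow> bool"
  where "stationary g x \<longleftrightarrow> g differentiable at x \<and> gradient g x = 0"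

end

theory Submission
  imports Defs
begin

text \<open>
  Write \<open>c'\<close> and \<open>A'\<close> for the derivatives at a feasible point \<open>x\<close>. Since \<open>c x = 0\<close>, the
  quadratic penalty contributes nothing to the first-order term, and since \<open>A x = x\<close>, the
  directional derivative of the penalty function along \<open>v\<close> is the inner product of \<open>A' v\<close> with the gradient of
  \<open>f\<close> at \<open>x\<close>. Hence \<open>x\<close> is stationary for the penalty function iff the gradient of \<open>f\<close> is orthogonal to the
  range of \<open>A'\<close> (lemma \<open>stationary_penalty_iff\<close>). On the other side, Lagrange multipliers
  exist iff the gradient lies in the range of the adjoint of \<open>c'\<close>, that is, iff it is
  orthogonal to the kernel of \<open>c'\<close> (lemmas \<open>constrained_stationary_iff\<close> and
  \<open>orthogonal_kernel_imp_in_range_adjoint\<close>). So it suffices that the range of \<open>A'\<close> be the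
  kernel of \<open>c'\<close>.

  One inclusion is the hypothesis that the product of the two transposed Jacobians vanishes. The
  other uses the constant rank: every \<open>v\<close> in the kernel of \<open>c'\<close> is the velocity at \<open>x\<close> of a
  curve that stays feasible (lemma \<open>constant_rank_curve\<close>, obtained from the inverse function
  theorem). As \<open>A\<close> fixes the points of that curve, \<open>A' v = v\<close>
  (lemma \<open>constant_rank_retraction_derivative\<close>), so \<open>v\<close> is in the range of \<open>A'\<close>.
\<close>

section \<open>Feasible curves from constant rank\<close>

text \<open>
  A right inverse of \<open>f\<close> on its image, with values in \<open>V\<close>, is injective; by equality of
  dimensions its image fills \<open>V\<close>.
\<close>

lemma dim_preserving_linear_inj_on:
  fixes f :: "'a::euclidean_space \<Rightarrow> 'b::euclidean_space"
  assumes "linear f" "subspace V" "dim (f ` V) = dim V"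
    and "u \<in> V" "f u = 0"
  shows "u = 0"
proof -
  obtain g where g: "range g \<subseteq> V" "linear g" and fg: "\<And>w. w \<in> f ` V \<Longrightarrow> f (g w) = w"
    using linear_exists_right_inverse_on[OF assms(1,2)] by blast
  have sub: "subspace (f ` V)"
    using assms by (simp add: linear_subspace_image)
  have "inj_on g (f ` V)"
    by (rule inj_on_inverseI[of _ f]) (rule fg)
  then have "dim (g ` f ` V) = dim (f ` V)"
    by (intro dim_image_eq[OF \<open>linear g\<close>]) (simp add: span_eq_iff[THEN iffD2, OF sub])
  then have "dim V \<le> dim (g ` f ` V)"
    using assms(3) by simp
  moreover have "subspace (g ` f ` V)"
    using sub g(2) by (simp add: linear_subspace_image)
  moreover have "g ` f ` V \<subseteq> V"
    using g(1) by blast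
  ultimately have "g ` f ` V = V"
    using subspace_dim_equal[OF _ \<open>subspace V\<close>] by blast
  then obtain w where "w \<in> f ` V" "u = g w"
    using \<open>u \<in> V\<close> by blast
  with fg[of w] \<open>f u = 0\<close> linear_0[OF \<open>linear g\<close>] show ?thesis by simp
qed

text \<open>
  This is where equality of ranks enters. The map \<open>T\<close> is a generalised inverse of \<open>D\<close>, and the
  map assumed surjective is the identity perturbed by \<open>T \<circ> (C - D)\<close>. Applying \<open>D\<close> to it leaves
  \<open>D \<circ> T \<circ> C\<close>, so \<open>D \<circ> T\<close> maps the range of \<open>C\<close> onto the range of \<open>D\<close>. Equal ranks then make
  \<open>D \<circ> T\<close> injective on the range of \<open>C\<close>.
\<close>

lemma kernel_of_equal_rank_perturbation:
  fixes C D :: "'a::euclidean_space \<Rightarrow> 'b::euclidean_space" and T :: "'b \<Rightarrow> 'a"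
  assumes lin: "linear C" "linear D" "linear T"
    and DTD: "\<And>h. D (T (D h)) = D h"
    and surj: "surj (\<lambda>h. T (C h) + h - T (D h))"
    and rank: "dim (range C) = dim (range D)"
    and zero: "D (T (C w)) = 0"
  shows "C w = 0"
proof (rule dim_preserving_linear_inj_on[where f = "D \<circ> T" and V = "range C"])
  show "linear (D \<circ> T)"
    using lin by (simp add: linear_compose)
  show "subspace (range C)"
    using lin by (simp add: linear_subspace_image)
  have "D (T (C h) + h - T (D h)) = D (T (C h))" for h
    using lin DTD by (simp add: linear_add linear_diff)
  then have "(D \<circ> T) ` range C = D ` range (\<lambda>h. T (C h) + h - T (D h))"
    by (simp add: image_image)
  then show "dim ((D \<circ> T) ` range C) = dim (range C)"
    using surj rank by simp
qed (use zero in auto)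

lemma linear_blinfun_apply: "linear (blinfun_apply L)"
  by (rule bounded_linear.linear[OF blinfun.bounded_linear_right])

text \<open>
  The part of the constant rank theorem needed here: the kernel of the derivative consists of
  velocities of curves in the level set. With \<open>D = C x\<close> and a generalised inverse \<open>T\<close> of \<open>D\<close>, the
  map \<open>\<Phi> y = T (c y) + (y - x) - T (D (y - x))\<close> has derivative the identity at \<open>x\<close>, hence a
  local inverse, and the curve is the preimage under \<open>\<Phi>\<close> of the line through \<open>\<Phi> x\<close> in
  direction \<open>v\<close>. Its velocity \<open>w\<close> at any time satisfies \<open>\<Phi>' w = v\<close>. Applying \<open>D\<close> gives
  \<open>D (T (C w)) = D v = 0\<close>, and constancy of the rank upgrades this to \<open>C w = 0\<close>, so \<open>c\<close> does
  not change along the curve.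
\<close>

lemma constant_rank_curve:
  fixes c :: "'a::euclidean_space \<Rightarrow> 'b::euclidean_space" and C :: "'a \<Rightarrow> ('a \<Rightarrow>\<^sub>L 'b)"
  assumes "open U" "x \<in> U"
    and deriv: "\<And>y. y \<in> U \<Longrightarrow> (c has_derivative blinfun_apply (C y)) (at y)"
    and cont: "continuous_on U C"
    and rank: "\<And>y. y \<in> U \<Longrightarrow> dim (range (blinfun_apply (C y))) = r"
    and v: "blinfun_apply (C x) v = 0"
  obtains e \<gamma> where "e > 0" "\<gamma> 0 = x" "(\<gamma> has_vector_derivative v) (at 0)"
    "\<And>t::real. \<bar>t\<bar> < e \<Longrightarrow> c (\<gamma> t) = c x"
proof -
  define D where "D = C x"
  obtain T0 where "linear T0" and T0: "\<And>w. w \<in> range D \<Longrightarrow> D (T0 w) = w"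
    using linear_exists_right_inverse_on[of D, OF _ subspace_UNIV]
    by (auto simp: linear_blinfun_apply)
  define T where "T = Blinfun T0"
  have T: "blinfun_apply T = T0"
    unfolding T_def using \<open>linear T0\<close>
    by (simp add: bounded_linear_Blinfun_apply linear_conv_bounded_linear)
  have DTD: "D (T (D h)) = D h" for h
    using T0 T by simp
  define \<Phi> where "\<Phi> y = T (c y) + (y - x) - T (D (y - x))" for y
  define \<Phi>' where "\<Phi>' y = (T o\<^sub>L C y) + id_blinfun - (T o\<^sub>L D)" for y
  have deriv_\<Phi>: "(\<Phi> has_derivative blinfun_apply (\<Phi>' y)) (at y)" if "y \<in> U" for y
    unfolding \<Phi>_def \<Phi>'_def using deriv[OF that]
    by (auto intro!: derivative_eq_intros simp: fun_eq_iff blinfun.bilinear_simps)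
  have cont_\<Phi>': "continuous_on U \<Phi>'"
    unfolding \<Phi>'_def by (intro continuous_intros cont)
  have \<Phi>'_x: "\<Phi>' x = id_blinfun"
    by (simp add: \<Phi>'_def D_def)
  have left_inverse_x: "id_blinfun o\<^sub>L \<Phi>' x = id_blinfun"
    by (simp add: \<Phi>'_x blinfun_eqI)
  obtain U' V g g' where U': "open U'" "U' \<subseteq> U" "x \<in> U'" and V: "open V" "\<Phi> x \<in> V"
    and hom: "homeomorphism U' V \<Phi> g"
    and deriv_g: "\<And>z. z \<in> V \<Longrightarrow> (g has_derivative (g' z)) (at z)"
    and g': "\<And>z. z \<in> V \<Longrightarrow> g' z = inv (blinfun_apply (\<Phi>' (g z)))"
    and bij: "\<And>z. z \<in> V \<Longrightarrow> bij (blinfun_apply (\<Phi>' (g z)))"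
    apply (rule inverse_function_theorem[OF \<open>open U\<close> deriv_\<Phi> cont_\<Phi>' \<open>x \<in> U\<close> left_inverse_x], assumption)
    subgoal for U' V g g'
      by (rule that[of U' V g g'])
    done
  define \<gamma> where "\<gamma> t = g (\<Phi> x + t *\<^sub>R v)" for t :: real
  have "open ((\<lambda>t. \<Phi> x + t *\<^sub>R v) -` V)"
    by (intro open_vimage V continuous_intros)
  moreover have "0 \<in> (\<lambda>t. \<Phi> x + t *\<^sub>R v) -` V"
    using V by simp
  ultimately obtain e where "e > 0" and "ball 0 e \<subseteq> (\<lambda>t. \<Phi> x + t *\<^sub>R v) -` V"
    by (rule openE)
  then have e: "\<Phi> x + t *\<^sub>R v \<in> V" if "\<bar>t\<bar> < e" for t
    using that by (auto simp: subset_iff)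
  have \<gamma>_0: "\<gamma> 0 = x"
    using hom U' by (simp add: \<gamma>_def homeomorphism_apply1)
  have \<gamma>_U: "\<gamma> t \<in> U" if "\<bar>t\<bar> < e" for t
    using homeomorphism_image2[OF hom] U' e[OF that] unfolding \<gamma>_def by blast
  have deriv_\<gamma>: "(\<gamma> has_derivative (\<lambda>s. s *\<^sub>R inv (\<Phi>' (\<gamma> t)) v)) (at t)" if "\<bar>t\<bar> < e" for t
  proof -
    have "((\<lambda>t. \<Phi> x + t *\<^sub>R v) has_derivative (\<lambda>s. s *\<^sub>R v)) (at t)"
      by (auto intro!: derivative_eq_intros)
    from has_derivative_compose[OF this deriv_g[OF e[OF that]]]
    have *: "(\<gamma> has_derivative (\<lambda>s. g' (\<Phi> x + t *\<^sub>R v) (s *\<^sub>R v))) (at t)"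
      by (simp add: \<gamma>_def[abs_def])
    have "linear (g' (\<Phi> x + t *\<^sub>R v))"
      using deriv_g[OF e[OF that]] has_derivative_linear by blast
    then show ?thesis
      using * g'[OF e[OF that]] by (simp add: linear_scale \<gamma>_def)
  qed
  show thesis
  proof
    show "e > 0" "\<gamma> 0 = x" by fact+
    show "(\<gamma> has_vector_derivative v) (at 0)"
      using deriv_\<gamma>[of 0] \<open>e > 0\<close> \<gamma>_0 \<Phi>'_x
      by (simp add: has_vector_derivative_def id_def[symmetric])
  next
    fix t :: real
    assume "\<bar>t\<bar> < e"
    have deriv_0: "((\<lambda>t. c (\<gamma> t)) has_derivative (\<lambda>s. 0)) (at t)" if t: "\<bar>t\<bar> < e" for t
    proof -
      define w where "w = inv (\<Phi>' (\<gamma> t)) v"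
      have bij_t: "bij (\<Phi>' (\<gamma> t))"
        using bij[OF e[OF t]] by (simp add: \<gamma>_def)
      then have "\<Phi>' (\<gamma> t) w = v"
        by (simp add: w_def bij_is_surj surj_f_inv_f)
      then have "D (\<Phi>' (\<gamma> t) w) = 0"
        using v by (simp add: D_def)
      then have zero: "D (T (C (\<gamma> t) w)) = 0"
        by (simp add: \<Phi>'_def blinfun.bilinear_simps DTD)
      have surj: "surj (\<lambda>h. T (C (\<gamma> t) h) + h - T (D h))"
        using bij_is_surj[OF bij_t] by (simp add: \<Phi>'_def blinfun.bilinear_simps)
      have same_rank: "dim (range (C (\<gamma> t))) = dim (range D)"
        using rank \<gamma>_U[OF t] \<open>x \<in> U\<close> by (simp add: D_def)
      have "C (\<gamma> t) w = 0"
        by (rule kernel_of_equal_rank_perturbation[OF linear_blinfun_apply linear_blinfun_apply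
              linear_blinfun_apply DTD surj same_rank zero])
      moreover have "((\<lambda>t. c (\<gamma> t)) has_derivative (\<lambda>s. C (\<gamma> t) (s *\<^sub>R w))) (at t)"
        using has_derivative_compose[OF deriv_\<gamma>[OF t] deriv[OF \<gamma>_U[OF t]]] by (simp add: w_def)
      ultimately show ?thesis
        by (simp add: blinfun.bilinear_simps)
    qed
    have "c (\<gamma> t) = c (\<gamma> 0)"
    proof (rule has_derivative_zero_unique[where f = "\<lambda>t. c (\<gamma> t)" and s = "ball 0 e"])
      show "((\<lambda>t. c (\<gamma> t)) has_derivative (\<lambda>s. 0)) (at s within ball 0 e)"
        if "s \<in> ball 0 e" for s
        using that by (simp add: has_derivative_at_withinI[OF deriv_0])
    qed (use \<open>\<bar>t\<bar> < e\<close> \<open>e > 0\<close> in auto)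
    then show "c (\<gamma> t) = c x"
      by (simp add: \<gamma>_0)
  qed
qed

text \<open>
  Differentiating \<open>A (\<gamma> t) = \<gamma> t\<close> at \<open>t = 0\<close> along the curve of \<open>constant_rank_curve\<close> gives
  \<open>A' v = v\<close>.
\<close>

lemma constant_rank_retraction_derivative:
  fixes c :: "'a::euclidean_space \<Rightarrow> 'b::euclidean_space" and C :: "'a \<Rightarrow> ('a \<Rightarrow>\<^sub>L 'b)"
  assumes "open U" "x \<in> U"
    and "\<And>y. y \<in> U \<Longrightarrow> (c has_derivative blinfun_apply (C y)) (at y)"
    and "continuous_on U C"
    and "\<And>y. y \<in> U \<Longrightarrow> dim (range (blinfun_apply (C y))) = r"
    and "blinfun_apply (C x) v = 0"
    and A': "(A has_derivative A') (at x)"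
    and fixes_level: "\<And>y. c y = c x \<Longrightarrow> A y = y"
  shows "A' v = v"
proof -
  obtain e \<gamma> where "e > 0" and \<gamma>: "\<gamma> 0 = x" "(\<gamma> has_vector_derivative v) (at 0)"
    and level: "\<And>t::real. \<bar>t\<bar> < e \<Longrightarrow> c (\<gamma> t) = c x"
    using constant_rank_curve[OF assms(1-6)] by blast
  have "linear A'"
    using A' by (rule has_derivative_linear)
  have "((\<lambda>t. A (\<gamma> t)) has_derivative (\<lambda>s. A' (s *\<^sub>R v))) (at 0)"
    using has_derivative_compose[of \<gamma> "\<lambda>s. s *\<^sub>R v" 0 UNIV A A'] \<gamma> A'
    by (simp add: has_vector_derivative_def)
  then have "((\<lambda>t. A (\<gamma> t)) has_vector_derivative A' v) (at 0)"
    by (simp add: has_vector_derivative_def linear_scale[OF \<open>linear A'\<close>])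
  then have "(\<gamma> has_vector_derivative A' v) (at 0)"
    by (rule has_vector_derivative_transform_within_open[where S = "ball 0 e"])
      (use \<open>e > 0\<close> level fixes_level in \<open>auto simp: dist_real_def\<close>)
  with \<gamma>(2) show ?thesis
    using vector_derivative_unique_at by blast
qed

section \<open>Stationarity in terms of derivatives\<close>

text \<open>
  Split \<open>u = y + z\<close> with \<open>y\<close> in the range of the adjoint and \<open>z\<close> orthogonal to it. Then \<open>z\<close> lies
  in the kernel of \<open>f\<close>, so \<open>z\<close> is orthogonal to \<open>u\<close>, hence to itself.
\<close>

lemma orthogonal_kernel_imp_in_range_adjoint:
  fixes f :: "'a::euclidean_space \<Rightarrow> 'b::euclidean_space"
  assumes "linear f" and orth: "\<And>v. f v = 0 \<Longrightarrow> v \<bullet> u = 0"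
  shows "u \<in> range (adjoint f)"
proof -
  let ?S = "range (adjoint f)"
  have "subspace ?S"
    using \<open>linear f\<close> by (simp add: adjoint_linear linear_subspace_image)
  then obtain y z where "y \<in> ?S" and z: "\<And>w. w \<in> ?S \<Longrightarrow> orthogonal z w" and u: "u = y + z"
    by (metis orthogonal_subspace_decomp_exists[of ?S u] span_eq_iff)
  have "f z \<bullet> f z = 0"
    using z[of "adjoint f (f z)"] adjoint_works[OF \<open>linear f\<close>] by (simp add: orthogonal_def)
  then have "z \<bullet> u = 0"
    using orth by simp
  moreover have "z \<bullet> y = 0"
    using z \<open>y \<in> ?S\<close> by (simp add: orthogonal_def)
  ultimately have "z = 0"
    by (simp add: u inner_right_distrib)
  with u \<open>y \<in> ?S\<close> show ?thesis by simp
qed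

lemma inner_gradient:
  fixes g :: "'a::euclidean_space \<Rightarrow> real"
  assumes "(g has_derivative g') (at x)"
  shows "h \<bullet> gradient g x = g' h"
proof -
  have "linear g'"
    using assms by (rule has_derivative_linear)
  then have g': "g' = (\<lambda>h. h \<bullet> adjoint g' 1)"
    by (simp add: adjoint_works)
  then have "GDERIV g x :> adjoint g' 1"
    using assms unfolding gderiv_def by simp
  then show ?thesis
    using g' gradient_eq by metis
qed

lemma has_derivative_tjacobian:
  fixes F :: "real ^ 'n \<Rightarrow> real ^ 'm"
  assumes "F differentiable at y"
  shows "(F has_derivative (\<lambda>h. transpose (tjacobian F y) *v h)) (at y)"
  using jacobian_works[THEN iffD1, OF assms] by (simp add: tjacobian_def)

lemma locally_lipschitz_imp_continuous_on:
  assumes "locally_lipschitz F"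
  shows "continuous_on S F"
proof (rule continuous_at_imp_continuous_on, rule ballI)
  fix x
  obtain r L where "r > 0" "L-lipschitz_on (ball x r) F"
    using assms unfolding locally_lipschitz_def by blast
  then show "isCont F x"
    using lipschitz_on_continuous_on continuous_on_eq_continuous_at[of "ball x r" F] by force
qed

text \<open>
  The combination of constraint gradients with multiplier \<open>l\<close> is the adjoint of the derivative
  applied to \<open>l\<close>.
\<close>

lemma constrained_stationary_iff:
  fixes f :: "real ^ 'n \<Rightarrow> real" and c :: "real ^ 'n \<Rightarrow> real ^ 'p"
  assumes c': "(c has_derivative c') (at x)"
  shows "constrained_stationary f c x \<longleftrightarrow> c x = 0 \<and> gradient f x \<in> range (adjoint c')"
proof -
  have "linear c'"
    using c' by (rule has_derivative_linear)
  have comp: "h \<bullet> gradient (\<lambda>y. c y $ i) x = c' h $ i" for h i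
    by (rule inner_gradient)
      (rule bounded_linear.has_derivative[OF bounded_linear_vec_nth c'])
  have "(\<Sum>i\<in>UNIV. (l $ i) *\<^sub>R gradient (\<lambda>y. c y $ i) x) = adjoint c' l" for l
  proof (rule vector_eq_ldot[THEN iffD1, OF allI])
    fix h
    have "h \<bullet> (\<Sum>i\<in>UNIV. (l $ i) *\<^sub>R gradient (\<lambda>y. c y $ i) x) = (\<Sum>i\<in>UNIV. l $ i * c' h $ i)"
      by (simp add: inner_sum_right comp)
    also have "\<dots> = h \<bullet> adjoint c' l"
      unfolding adjoint_works[OF \<open>linear c'\<close>] by (simp add: inner_vec_def mult.commute)
    finally show "h \<bullet> (\<Sum>i\<in>UNIV. (l $ i) *\<^sub>R gradient (\<lambda>y. c y $ i) x) = h \<bullet> adjoint c' l" .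
  qed
  then show ?thesis
    unfolding constrained_stationary_def by auto
qed

text \<open>
  The squared norm of \<open>c\<close> has derivative \<open>2 * (c x \<bullet> c' h)\<close>, which vanishes at feasible points.
  The chain rule for \<open>f (A y)\<close> then gives the whole gradient of the penalty function.
\<close>

lemma stationary_penalty_iff:
  fixes f :: "real ^ 'n \<Rightarrow> real" and c :: "real ^ 'n \<Rightarrow> real ^ 'p"
  assumes f': "f differentiable at x"
    and c': "(c has_derivative c') (at x)"
    and A': "(A has_derivative A') (at x)"
    and "c x = 0" "A x = x"
  shows "stationary (penalty f c A \<beta>) x \<longleftrightarrow> (\<forall>h. A' h \<bullet> gradient f x = 0)"
proof -
  obtain f' where f': "(f has_derivative f') (at x)"
    using f' by (auto simp: differentiable_def)
  have "((\<lambda>y. f (A y)) has_derivative (\<lambda>h. f' (A' h))) (at x)"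
    using has_derivative_compose[OF A'] f' \<open>A x = x\<close> by metis
  then have "(penalty f c A \<beta> has_derivative (\<lambda>h. f' (A' h))) (at x)"
    unfolding penalty_def[abs_def] power2_norm_eq_inner
    using c' \<open>c x = 0\<close> by (auto intro!: derivative_eq_intros)
  then have "h \<bullet> gradient (penalty f c A \<beta>) x = A' h \<bullet> gradient f x"
    and "penalty f c A \<beta> differentiable at x" for h
    using inner_gradient f' by (metis, auto simp: differentiable_def)
  then show ?thesis
    unfolding stationary_def by (metis inner_zero_right inner_eq_zero_iff)
qed

section \<open>Equivalence of the two notions of stationarity\<close>

theorem proposition6:
  fixes f :: "real ^ 'n \<Rightarrow> real"
    and c :: "real ^ 'n \<Rightarrow> real ^ 'p"
    and A :: "real ^ 'n \<Rightarrow> real ^ 'n"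
    and X :: "(real ^ 'n) set"
    and p' :: nat
    and \<beta> :: real
    and x :: "real ^ 'n"
  assumes f_lipschitz: "locally_lipschitz f"
    and f_differentiable: "\<And>y. f differentiable at y"
    and c_differentiable: "\<And>y. c differentiable at y"
    and Jc_lipschitz: "locally_lipschitz (tjacobian c)"
    and p'_bounds: "1 \<le> p'" "p' \<le> CARD('p)"
    and X_neighborhood: "feasible_set c \<subseteq> interior X"
    and constant_rank: "\<And>y. y \<in> X \<Longrightarrow> rank (tjacobian c y) = p'"
    and A_differentiable: "\<And>y. A differentiable at y"
    and JA_lipschitz: "locally_lipschitz (tjacobian A)"
    and A_fixes: "\<And>y. y \<in> feasible_set c \<Longrightarrow> A y = y"
    and JA_Jc: "\<And>y. y \<in> feasible_set c \<Longrightarrow> tjacobian A y ** tjacobian c y = 0"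
    and x_feasible: "x \<in> feasible_set c"
  shows "constrained_stationary f c x \<longleftrightarrow> stationary (penalty f c A \<beta>) x"
proof -
  define c' where "c' y = (*v) (transpose (tjacobian c y))" for y
  define A' where "A' = (*v) (transpose (tjacobian A x))"
  define C where "C y = Blinfun (c' y)" for y
  have c': "(c has_derivative c' y) (at y)" for y
    unfolding c'_def using c_differentiable by (rule has_derivative_tjacobian)
  have A': "(A has_derivative A') (at x)"
    unfolding A'_def using A_differentiable by (rule has_derivative_tjacobian)
  have C: "blinfun_apply (C y) = c' y" for y
    unfolding C_def using c' has_derivative_bounded_linear
    by (blast intro: bounded_linear_Blinfun_apply)
  have lin: "linear (c' x)"
    using c' by (rule has_derivative_linear)
  have [simp]: "c x = 0" "A x = x"
    using x_feasible A_fixes by (auto simp: feasible_set_def)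
  \<comment> \<open>The two facts below say that the range of \<open>A'\<close> equals the kernel of \<open>c' x\<close>.\<close>
  have normal: "c' x (A' h) = 0" for h
  proof -
    have "transpose (tjacobian c x) ** transpose (tjacobian A x) = 0"
      unfolding matrix_transpose_mul[symmetric] JA_Jc[OF x_feasible]
      by (simp add: transpose_def vec_eq_iff)
    then show ?thesis
      by (simp add: c'_def A'_def matrix_vector_mul_assoc del: transpose_matrix_vector)
  qed
  have tangent: "A' v = v" if "c' x v = 0" for v
  proof (rule constant_rank_retraction_derivative[where U = "interior X" and C = C and c = c and A = A])
    have "continuous_on S (tjacobian c)" for S
      using Jc_lipschitz by (rule locally_lipschitz_imp_continuous_on)
    then show "continuous_on (interior X) C"
      by (intro continuous_on_blinfun_componentwise)
        (auto simp: C c'_def matrix_vector_mult_def transpose_def intro!: continuous_intros)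
    show "dim (range (C y)) = p'" if "y \<in> interior X" for y
      using constant_rank[of y] that interior_subset[of X]
      by (simp add: C c'_def rank_dim_range[symmetric] rank_transpose subset_eq
          del: transpose_matrix_vector)
  qed (use x_feasible X_neighborhood that c' A' A_fixes in \<open>auto simp: C feasible_set_def\<close>)
  show ?thesis
    unfolding constrained_stationary_iff[OF c']
      stationary_penalty_iff[OF f_differentiable c' A' \<open>c x = 0\<close> \<open>A x = x\<close>]
  proof safe
    fix l h
    assume "gradient f x = adjoint (c' x) l"
    then show "A' h \<bullet> gradient f x = 0"
      by (simp add: adjoint_works[OF lin] normal)
  next
    assume "\<forall>h. A' h \<bullet> gradient f x = 0"
    then have "v \<bullet> gradient f x = 0" if "c' x v = 0" for v
      using tangent[OF that] by metis
    then show "gradient f x \<in> range (adjoint (c' x))"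
      using orthogonal_kernel_imp_in_range_adjoint[OF lin] by blast
  qed simp
qed

end
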